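(* Let $X$ be a topological module over a topological ring $R$, and let $B_{\frac n2}(X\times X)$ be the set of all $\frac n2$-bounded bigroup homomorphisms $X\times X\to X$, with pointwise addition and pointwise multiplication by elements of $R$. Then addition and module multiplication in $B_{\frac n2}(X\times X)$ are continuous with respect to $\sigma$-uniform convergence on some zero neighborhood. That is, if $(\sigma_\alpha)$ and $(\gamma_\alpha)$ are nets in $B_{\frac n2}(X\times X)$ and $(r_\alpha)$ is a net in $R$, all indexed by the same directed set, such that $\sigma_\alpha\to\sigma\in B_{\frac n2}(X\times X)$ and $\gamma_\alpha\to\gamma\in B_{\frac n2}(X\times X)$ $\sigma$-uniformly on some zero neighborhood and $r_\alpha\to r$ in $R$, then $\sigma_\alpha+\gamma_\alpha\to\sigma+\gamma$ and $r_\alpha\sigma_\alpha\to r\sigma$ $\sigma$-uniformly on some zero neighborhood.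
   Context: A topological module $X$ over a topological ring $R$ is an $R$-module with a topology making $X$ a topological additive group and making the multiplication $R\times X\to X$ (jointly) continuous. A zero neighborhood is a neighborhood of $0$. A set $B\subseteq X$ is bounded if for each zero neighborhood $W\subseteq X$ there is a zero neighborhood $V\subseteq R$ such that $VB\subseteq W$, where $VB=\{vb: v\in V, b\in B\}$. A bigroup homomorphism $\sigma:X\times X\to X$ is a map that is a homomorphism of additive groups in each variable separately. For $A,B\subseteq X$, $\sigma(A,B)=\{\sigma(a,b):a\in A,b\in B\}$. $\sigma$ is $\frac n2$-bounded if there exists a zero neighborhood $U\subseteq X$ such that for each bounded set $B\subseteq X$, $\sigma(U,B)$ is bounded in $X$. A net $(\sigma_\alpha)$ of bigroup homomorphisms converges to zero $\sigma$-uniformly on some zero neighborhood (here "$\sigma$-uniformly" is just a name) if there exists a zero neighborhood $U\subseteq X$ such that for each zero neighborhood $W\subseteq X$ and each bounded set $B\subseteq X$ there is an $\alpha_0$ with $\sigma_\alpha(U,B)\subseteq W$ for all $\alpha\ge\alpha_0$. It converges to $\sigma$ in this sense if $(\sigma_\alpha-\sigma)$ converges to zero in this sense. *)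

theory Defs
  imports Complex_Main
begin

(* Rings need be neither commutative nor unital, modules are left modules, and no separation
   axiom is imposed on the topologies. *)

class topological_ring = ring + topological_ab_group_add + topological_semigroup_mult

locale topological_module =
  fixes scale :: "'r::topological_ring \<Rightarrow> 'x::topological_ab_group_add \<Rightarrow> 'x"
  assumes scale_add_right: "scale r (x + y) = scale r x + scale r y"
    and scale_add_left: "scale (r + s) x = scale r x + scale s x"
    and scale_scale: "scale r (scale s x) = scale (r * s) x"
    and continuous_scale: "continuous_on UNIV (\<lambda>(r, x). scale r x)"

definition zero_nhd :: "'a::{topological_space, zero} set \<Rightarrow> bool" where
  "zero_nhd U \<longleftrightarrow> (\<exists>S. open S \<and> 0 \<in> S \<and> S \<subseteq> U)"

definition module_bounded ::
  "('r::topological_ring \<Rightarrow> 'x::topological_ab_group_add \<Rightarrow> 'x) \<Rightarrow> 'x set \<Rightarrow> bool" where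
  "module_bounded scale B \<longleftrightarrow>
     (\<forall>W. zero_nhd W \<longrightarrow> (\<exists>V. zero_nhd V \<and> {scale v b | v b. v \<in> V \<and> b \<in> B} \<subseteq> W))"

definition bigroup_hom :: "('x::ab_group_add \<Rightarrow> 'x \<Rightarrow> 'x) \<Rightarrow> bool" where
  "bigroup_hom \<sigma> \<longleftrightarrow> (\<forall>y. additive (\<lambda>x. \<sigma> x y)) \<and> (\<forall>x. additive (\<lambda>y. \<sigma> x y))"

definition image2 :: "('a \<Rightarrow> 'b \<Rightarrow> 'c) \<Rightarrow> 'a set \<Rightarrow> 'b set \<Rightarrow> 'c set" where
  "image2 \<sigma> A B = {\<sigma> a b | a b. a \<in> A \<and> b \<in> B}"

definition n2_bounded ::
  "('r::topological_ring \<Rightarrow> 'x::topological_ab_group_add \<Rightarrow> 'x) \<Rightarrow> ('x \<Rightarrow> 'x \<Rightarrow> 'x) \<Rightarrow> bool" where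
  "n2_bounded scale \<sigma> \<longleftrightarrow>
     (\<exists>U. zero_nhd U \<and> (\<forall>B. module_bounded scale B \<longrightarrow> module_bounded scale (image2 \<sigma> U B)))"

definition B_n2 ::
  "('r::topological_ring \<Rightarrow> 'x::topological_ab_group_add \<Rightarrow> 'x) \<Rightarrow> ('x \<Rightarrow> 'x \<Rightarrow> 'x) set" where
  "B_n2 scale = {\<sigma>. bigroup_hom \<sigma> \<and> n2_bounded scale \<sigma>}"

locale directed_set =
  fixes D :: "'i set" and le :: "'i \<Rightarrow> 'i \<Rightarrow> bool"
  assumes nonempty: "D \<noteq> {}"
    and refl: "a \<in> D \<Longrightarrow> le a a"
    and trans: "\<lbrakk>a \<in> D; b \<in> D; c \<in> D; le a b; le b c\<rbrakk> \<Longrightarrow> le a c"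
    and directed: "\<lbrakk>a \<in> D; b \<in> D\<rbrakk> \<Longrightarrow> \<exists>c\<in>D. le a c \<and> le b c"

(* The filter of eventual truth along the directed set. *)
definition net_filter :: "'i set \<Rightarrow> ('i \<Rightarrow> 'i \<Rightarrow> bool) \<Rightarrow> 'i filter" where
  "net_filter D le = (INF a\<in>D. principal {b \<in> D. le a b})"

lemma (in directed_set) eventually_net_filter:
  "eventually P (net_filter D le) \<longleftrightarrow> (\<exists>a\<in>D. \<forall>b\<in>D. le a b \<longrightarrow> P b)"
proof -
  have "\<exists>c\<in>D. principal {b \<in> D. le c b} \<le> inf (principal {x \<in> D. le a x}) (principal {x \<in> D. le b x})"
    if ab: "a \<in> D" "b \<in> D" for a b
  proof -
    obtain c where c: "c \<in> D" "le a c" "le b c"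
      using directed[OF ab] by blast
    then have "{x \<in> D. le c x} \<subseteq> {x \<in> D. le a x} \<inter> {x \<in> D. le b x}"
      using ab trans by blast
    then show ?thesis
      using c(1) by auto
  qed
  then show ?thesis
    unfolding net_filter_def
    by (subst eventually_INF_base) (auto simp: nonempty eventually_principal)
qed

definition n2_null_net ::
  "('r::topological_ring \<Rightarrow> 'x::topological_ab_group_add \<Rightarrow> 'x) \<Rightarrow> 'i set \<Rightarrow> ('i \<Rightarrow> 'i \<Rightarrow> bool) \<Rightarrow>
   ('i \<Rightarrow> 'x \<Rightarrow> 'x \<Rightarrow> 'x) \<Rightarrow> bool" where
  "n2_null_net scale D le \<sigma> \<longleftrightarrow>
     (\<exists>U. zero_nhd U \<and>
        (\<forall>W B. zero_nhd W \<and> module_bounded scale B \<longrightarrow>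
           (\<exists>\<alpha>0\<in>D. \<forall>\<alpha>\<in>D. le \<alpha>0 \<alpha> \<longrightarrow> image2 (\<sigma> \<alpha>) U B \<subseteq> W)))"

definition n2_tendsto ::
  "('r::topological_ring \<Rightarrow> 'x::topological_ab_group_add \<Rightarrow> 'x) \<Rightarrow> 'i set \<Rightarrow> ('i \<Rightarrow> 'i \<Rightarrow> bool) \<Rightarrow>
   ('i \<Rightarrow> 'x \<Rightarrow> 'x \<Rightarrow> 'x) \<Rightarrow> ('x \<Rightarrow> 'x \<Rightarrow> 'x) \<Rightarrow> bool" where
  "n2_tendsto scale D le \<sigma> \<sigma>' \<longleftrightarrow> n2_null_net scale D le (\<lambda>\<alpha> x y. \<sigma> \<alpha> x y - \<sigma>' x y)"

definition bi_add :: "('x::plus \<Rightarrow> 'x \<Rightarrow> 'x) \<Rightarrow> ('x \<Rightarrow> 'x \<Rightarrow> 'x) \<Rightarrow> 'x \<Rightarrow> 'x \<Rightarrow> 'x" where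
  "bi_add \<sigma> \<gamma> = (\<lambda>x y. \<sigma> x y + \<gamma> x y)"

definition bi_scale :: "('r \<Rightarrow> 'x \<Rightarrow> 'x) \<Rightarrow> 'r \<Rightarrow> ('x \<Rightarrow> 'x \<Rightarrow> 'x) \<Rightarrow> 'x \<Rightarrow> 'x \<Rightarrow> 'x" where
  "bi_scale scale r \<sigma> = (\<lambda>x y. scale r (\<sigma> x y))"

lemma zero_nhd_Int: "zero_nhd U \<Longrightarrow> zero_nhd V \<Longrightarrow> zero_nhd (U \<inter> V)"
  unfolding zero_nhd_def
proof (elim exE conjE)
  fix S T :: "'a set"
  assume "open S" "0 \<in> S" "S \<subseteq> U" "open T" "0 \<in> T" "T \<subseteq> V"
  then show "\<exists>S. open S \<and> 0 \<in> S \<and> S \<subseteq> U \<inter> V"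
    by (intro exI[of _ "S \<inter> T"]) auto
qed

lemma zero_nhd_split:
  fixes W :: "'x::topological_ab_group_add set"
  assumes "zero_nhd W"
  shows "\<exists>V. zero_nhd V \<and> (\<forall>a\<in>V. \<forall>b\<in>V. a + b \<in> W)"
proof -
  obtain S where S: "open S" "0 \<in> S" "S \<subseteq> W"
    using assms unfolding zero_nhd_def by blast
  have "((\<lambda>p. fst p + snd p) \<longlongrightarrow> (0::'x)) (nhds 0 \<times>\<^sub>F nhds 0)"
    using tendsto_add_Pair[of "0::'x" 0] by simp
  then have "eventually (\<lambda>p. fst p + snd p \<in> S) (nhds (0::'x) \<times>\<^sub>F nhds 0)"
    by (rule topological_tendstoD) (simp_all add: S)
  then obtain P Q where P: "eventually P (nhds (0::'x))" and Q: "eventually Q (nhds (0::'x))"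
    and PQ: "\<forall>x y. P x \<longrightarrow> Q y \<longrightarrow> fst (x, y) + snd (x, y) \<in> S"
    unfolding eventually_prod_filter by (elim exE conjE)
  obtain T where T: "open T" "0 \<in> T" "\<forall>x\<in>T. P x \<and> Q x"
    using eventually_conj[OF P Q] unfolding eventually_nhds by (elim exE conjE)
  have "zero_nhd T"
    unfolding zero_nhd_def using T(1,2) by (intro exI[of _ T]) simp
  moreover have "\<forall>a\<in>T. \<forall>b\<in>T. a + b \<in> W"
    using T(3) PQ S(3) by auto
  ultimately show ?thesis
    by (intro exI conjI)
qed

lemma module_bounded_iff:
  "module_bounded scale B \<longleftrightarrow>
     (\<forall>W. zero_nhd W \<longrightarrow> (\<exists>V. zero_nhd V \<and> (\<forall>v\<in>V. \<forall>b\<in>B. scale v b \<in> W)))"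
proof -
  have "{scale v b | v b. v \<in> V \<and> b \<in> B} \<subseteq> W \<longleftrightarrow> (\<forall>v\<in>V. \<forall>b\<in>B. scale v b \<in> W)" for V W
    by auto
  then show ?thesis
    by (simp add: module_bounded_def)
qed

lemma ball_image2: "(\<forall>z\<in>image2 \<sigma> A B. P z) \<longleftrightarrow> (\<forall>a\<in>A. \<forall>b\<in>B. P (\<sigma> a b))"
  by (auto simp: image2_def)

context topological_module
begin

lemma B_n2_add_closed:
  assumes "\<sigma> \<in> B_n2 scale" "\<gamma> \<in> B_n2 scale"
  shows "bi_add \<sigma> \<gamma> \<in> B_n2 scale"
proof -
  have "bigroup_hom \<sigma>" "bigroup_hom \<gamma>"
    using assms by (simp_all add: B_n2_def)
  then have hom: "bigroup_hom (bi_add \<sigma> \<gamma>)"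
    by (simp add: bigroup_hom_def bi_add_def additive_def add_ac)
  have "n2_bounded scale \<sigma>" "n2_bounded scale \<gamma>"
    using assms by (simp_all add: B_n2_def)
  then obtain U1 U2 where U: "zero_nhd U1" "zero_nhd U2"
    and U1: "\<forall>B. module_bounded scale B \<longrightarrow> module_bounded scale (image2 \<sigma> U1 B)"
    and U2: "\<forall>B. module_bounded scale B \<longrightarrow> module_bounded scale (image2 \<gamma> U2 B)"
    unfolding n2_bounded_def by (elim exE conjE)
  have "module_bounded scale (image2 (bi_add \<sigma> \<gamma>) (U1 \<inter> U2) B)" if B: "module_bounded scale B" for B
    unfolding module_bounded_iff[of scale "image2 _ _ _"] ball_image2
  proof (intro allI impI)
    fix W :: "'x set" assume "zero_nhd W"
    from zero_nhd_split[OF this] obtain W' where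
      W': "zero_nhd W'" "\<forall>a\<in>W'. \<forall>b\<in>W'. a + b \<in> W"
      by (elim exE conjE)
    have "\<exists>V. zero_nhd V \<and> (\<forall>v\<in>V. \<forall>z\<in>image2 \<sigma> U1 B. scale v z \<in> W')"
      using U1[rule_format, OF B, unfolded module_bounded_iff] W'(1) by simp
    then obtain V1 where V1: "zero_nhd V1" "\<forall>v\<in>V1. \<forall>u\<in>U1. \<forall>b\<in>B. scale v (\<sigma> u b) \<in> W'"
      unfolding ball_image2 by (elim exE conjE)
    have "\<exists>V. zero_nhd V \<and> (\<forall>v\<in>V. \<forall>z\<in>image2 \<gamma> U2 B. scale v z \<in> W')"
      using U2[rule_format, OF B, unfolded module_bounded_iff] W'(1) by simp
    then obtain V2 where V2: "zero_nhd V2" "\<forall>v\<in>V2. \<forall>u\<in>U2. \<forall>b\<in>B. scale v (\<gamma> u b) \<in> W'"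
      unfolding ball_image2 by (elim exE conjE)
    have "\<forall>v\<in>V1 \<inter> V2. \<forall>u\<in>U1 \<inter> U2. \<forall>b\<in>B. scale v (bi_add \<sigma> \<gamma> u b) \<in> W"
      using V1(2) V2(2) W'(2) by (simp add: bi_add_def scale_add_right)
    then show "\<exists>V. zero_nhd V \<and> (\<forall>v\<in>V. \<forall>u\<in>U1 \<inter> U2. \<forall>b\<in>B. scale v (bi_add \<sigma> \<gamma> u b) \<in> W)"
      using zero_nhd_Int[OF V1(1) V2(1)] by (intro exI conjI)
  qed
  then have "n2_bounded scale (bi_add \<sigma> \<gamma>)"
    unfolding n2_bounded_def using zero_nhd_Int[OF U] by (intro exI[of _ "U1 \<inter> U2"]) simp
  with hom show ?thesis
    by (simp add: B_n2_def)
qed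

lemma B_n2_scale_closed:
  assumes "\<sigma> \<in> B_n2 scale"
  shows "bi_scale scale r \<sigma> \<in> B_n2 scale"
proof -
  have "bigroup_hom \<sigma>"
    using assms by (simp add: B_n2_def)
  then have hom: "bigroup_hom (bi_scale scale r \<sigma>)"
    by (simp add: bigroup_hom_def bi_scale_def additive_def scale_add_right)
  have "n2_bounded scale \<sigma>"
    using assms by (simp add: B_n2_def)
  then obtain U where U: "zero_nhd U"
    and UB: "\<forall>B. module_bounded scale B \<longrightarrow> module_bounded scale (image2 \<sigma> U B)"
    unfolding n2_bounded_def by (elim exE conjE)
  have "module_bounded scale (image2 (bi_scale scale r \<sigma>) U B)" if B: "module_bounded scale B" for B
    unfolding module_bounded_iff[of scale "image2 _ _ _"] ball_image2
  proof (intro allI impI)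
    fix W :: "'x set" assume "zero_nhd W"
    then have "\<exists>V. zero_nhd V \<and> (\<forall>v\<in>V. \<forall>z\<in>image2 \<sigma> U B. scale v z \<in> W)"
      using UB[rule_format, OF B, unfolded module_bounded_iff] by simp
    then obtain V where V: "zero_nhd V" "\<forall>v\<in>V. \<forall>u\<in>U. \<forall>b\<in>B. scale v (\<sigma> u b) \<in> W"
      unfolding ball_image2 by (elim exE conjE)
    obtain S where S: "open S" "0 \<in> S" "S \<subseteq> V"
      using V(1) unfolding zero_nhd_def by (elim exE conjE)
    have "((\<lambda>v. v * r) \<longlongrightarrow> 0 * r) (nhds 0)"
      by (rule tendsto_mult_right) (simp add: filterlim_ident)
    then have "eventually (\<lambda>v. v * r \<in> S) (nhds 0)"
      by (rule topological_tendstoD) (simp_all add: S)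
    then obtain T where T: "open T" "0 \<in> T" "\<forall>v\<in>T. v * r \<in> S"
      unfolding eventually_nhds by (elim exE conjE)
    have "zero_nhd T"
      unfolding zero_nhd_def using T(1,2) by (intro exI[of _ T]) simp
    moreover have "\<forall>v\<in>T. \<forall>u\<in>U. \<forall>b\<in>B. scale v (bi_scale scale r \<sigma> u b) \<in> W"
      using V(2) T(3) S(3) by (simp add: bi_scale_def scale_scale subset_iff)
    ultimately show "\<exists>V. zero_nhd V \<and> (\<forall>v\<in>V. \<forall>u\<in>U. \<forall>b\<in>B. scale v (bi_scale scale r \<sigma> u b) \<in> W)"
      by (intro exI conjI)
  qed
  then have "n2_bounded scale (bi_scale scale r \<sigma>)"
    unfolding n2_bounded_def using U by (intro exI[of _ U]) simp
  with hom show ?thesis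
    by (simp add: B_n2_def)
qed

end

end

theory Submission
  imports Defs
begin

text \<open>
  The addition part is the usual argument: if two nets tend to zero uniformly on zero
  neighborhoods \<open>U\<^sub>1\<close> and \<open>U\<^sub>2\<close>, then both do so on
  \<open>U\<^sub>1 \<inter> U\<^sub>2\<close>, and a target neighborhood \<open>W\<close> is
  reached by aiming each summand at a \<open>W'\<close> with \<open>W' + W' \<subseteq> W\<close>.

  For the scalar multiplication, write
  \<open>r\<^sub>\<alpha> \<sigma>\<^sub>\<alpha> - r \<sigma> = r\<^sub>\<alpha> (\<sigma>\<^sub>\<alpha> - \<sigma>) + (r\<^sub>\<alpha> - r) \<sigma>\<close>.
  The first summand tends to zero because the multiplication is jointly continuous at
  \<open>(r, 0)\<close> (\<open>uniformly_null_scale\<close>), the second because scalars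
  tending to zero shrink the bounded sets \<open>\<sigma>(U, B)\<close>
  (\<open>uniformly_null_shrink\<close>). This is where \<open>n/2\<close>-boundedness of the limit
  enters: it supplies one \<open>U\<close> that serves all bounded \<open>B\<close>.
\<close>

text \<open>
  The neighborhood \<open>U\<close> is a parameter so that it can be shrunk until several nets
  share it; with a filter, finitely many eventual conditions combine without choosing indices.
\<close>

definition uniformly_null ::
  "('r::topological_ring \<Rightarrow> 'x::topological_ab_group_add \<Rightarrow> 'x) \<Rightarrow> 'i filter \<Rightarrow> 'x set \<Rightarrow>
   ('i \<Rightarrow> 'x \<Rightarrow> 'x \<Rightarrow> 'x) \<Rightarrow> bool" where
  "uniformly_null scale F U \<sigma>s \<longleftrightarrow>
     (\<forall>W B. zero_nhd W \<longrightarrow> module_bounded scale B \<longrightarrow>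
        (\<forall>\<^sub>F \<alpha> in F. \<forall>u\<in>U. \<forall>b\<in>B. \<sigma>s \<alpha> u b \<in> W))"

lemma uniformly_nullI:
  assumes "\<And>W B. zero_nhd W \<Longrightarrow> module_bounded scale B \<Longrightarrow>
             \<forall>\<^sub>F \<alpha> in F. \<forall>u\<in>U. \<forall>b\<in>B. \<sigma>s \<alpha> u b \<in> W"
  shows "uniformly_null scale F U \<sigma>s"
  using assms by (simp add: uniformly_null_def)

lemma uniformly_nullD:
  assumes "uniformly_null scale F U \<sigma>s" "zero_nhd W" "module_bounded scale B"
  shows "\<forall>\<^sub>F \<alpha> in F. \<forall>u\<in>U. \<forall>b\<in>B. \<sigma>s \<alpha> u b \<in> W"
  using assms by (simp add: uniformly_null_def)

lemma (in directed_set) n2_null_net_iff_uniformly_null: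
  "n2_null_net scale D le \<sigma>s \<longleftrightarrow>
     (\<exists>U. zero_nhd U \<and> uniformly_null scale (net_filter D le) U \<sigma>s)"
  by (simp add: n2_null_net_def uniformly_null_def eventually_net_filter subset_iff
      Ball_def[symmetric] ball_image2 imp_conjL)

lemma uniformly_null_subset:
  fixes scale :: "'r::topological_ring \<Rightarrow> 'x::topological_ab_group_add \<Rightarrow> 'x"
  assumes null: "uniformly_null scale F U \<sigma>s" and "U' \<subseteq> U"
  shows "uniformly_null scale F U' \<sigma>s"
proof (rule uniformly_nullI)
  fix W B :: "'x set" assume "zero_nhd W" "module_bounded scale B"
  from uniformly_nullD[OF null this]
  show "\<forall>\<^sub>F \<alpha> in F. \<forall>u\<in>U'. \<forall>b\<in>B. \<sigma>s \<alpha> u b \<in> W"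
    by eventually_elim (use \<open>U' \<subseteq> U\<close> in blast)
qed

lemma uniformly_null_add:
  fixes scale :: "'r::topological_ring \<Rightarrow> 'x::topological_ab_group_add \<Rightarrow> 'x"
  assumes \<sigma>s: "uniformly_null scale F U \<sigma>s" and \<gamma>s: "uniformly_null scale F U \<gamma>s"
  shows "uniformly_null scale F U (\<lambda>\<alpha> x y. \<sigma>s \<alpha> x y + \<gamma>s \<alpha> x y)"
proof (rule uniformly_nullI)
  fix W B :: "'x set" assume W: "zero_nhd W" and B: "module_bounded scale B"
  obtain W' where W': "zero_nhd W'" "\<And>a b. a \<in> W' \<Longrightarrow> b \<in> W' \<Longrightarrow> a + b \<in> W"
    using zero_nhd_split[OF W] by blast
  from uniformly_nullD[OF \<sigma>s W'(1) B] uniformly_nullD[OF \<gamma>s W'(1) B]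
  show "\<forall>\<^sub>F \<alpha> in F. \<forall>u\<in>U. \<forall>b\<in>B. \<sigma>s \<alpha> u b + \<gamma>s \<alpha> u b \<in> W"
    by eventually_elim (use W'(2) in blast)
qed

lemma eventually_in_zero_nhd:
  assumes "(f \<longlongrightarrow> 0) F" "zero_nhd V"
  shows "\<forall>\<^sub>F \<alpha> in F. f \<alpha> \<in> V"
proof -
  obtain S where S: "open S" "0 \<in> S" "S \<subseteq> V"
    using assms(2) unfolding zero_nhd_def by blast
  from topological_tendstoD[OF assms(1) S(1,2)] show ?thesis
    by eventually_elim (use S(3) in blast)
qed

context topological_module
begin

lemma scale_zero_right: "scale r 0 = 0"
  using scale_add_right[of r 0 0] by simp

lemma scale_diff_right: "scale r (x - y) = scale r x - scale r y"
  using scale_add_right[of r "x - y" y] by (simp add: algebra_simps)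

lemma scale_diff_left: "scale (r - s) x = scale r x - scale s x"
  using scale_add_left[of "r - s" s x] by (simp add: algebra_simps)

text \<open>
  This is joint continuity of the multiplication at \<open>(r, 0)\<close>, which is mapped to
  \<open>0\<close>. Separate continuity would give a \<open>W'\<close> for each scalar \<open>t\<close>,
  whereas a net of scalars near \<open>r\<close> needs a common one.
\<close>

lemma scale_into_zero_nhd:
  assumes "zero_nhd W"
  obtains T W' where "open T" "r \<in> T" "zero_nhd W'"
    "\<And>t w. t \<in> T \<Longrightarrow> w \<in> W' \<Longrightarrow> scale t w \<in> W"
proof -
  obtain S where S: "open S" "0 \<in> S" "S \<subseteq> W"
    using assms unfolding zero_nhd_def by blast
  have "open ((\<lambda>(r, x). scale r x) -` S)"
    using continuous_scale S(1) by (metis continuous_on_open_vimage Int_UNIV_right open_UNIV)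
  moreover have "(r, 0) \<in> (\<lambda>(r, x). scale r x) -` S"
    by (simp add: scale_zero_right S(2))
  ultimately obtain T T' where "open T" "open T'" "(r, 0) \<in> T \<times> T'"
    "T \<times> T' \<subseteq> (\<lambda>(r, x). scale r x) -` S"
    by (rule open_prod_elim)
  with S(3) show ?thesis
    by (intro that[of T T']) (auto simp: zero_nhd_def)
qed

text \<open>
  Once the scalars are close to \<open>r\<close>, they all map one zero neighborhood
  \<open>W'\<close> into \<open>W\<close>, so it is enough to bring \<open>\<sigma>s\<close> into
  \<open>W'\<close>, uniformly on \<open>U\<close> and \<open>B\<close>.
\<close>

lemma uniformly_null_scale:
  assumes null: "uniformly_null scale F U \<sigma>s" and rs: "(rs \<longlongrightarrow> r) F"
  shows "uniformly_null scale F U (\<lambda>\<alpha> x y. scale (rs \<alpha>) (\<sigma>s \<alpha> x y))"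
proof (rule uniformly_nullI)
  fix W B :: "'x set" assume W: "zero_nhd W" and B: "module_bounded scale B"
  obtain T W' where T: "open T" "r \<in> T" and W': "zero_nhd W'"
    and sub: "\<And>t w. t \<in> T \<Longrightarrow> w \<in> W' \<Longrightarrow> scale t w \<in> W"
    using scale_into_zero_nhd[OF W] by blast
  from topological_tendstoD[OF rs T] uniformly_nullD[OF null W' B]
  show "\<forall>\<^sub>F \<alpha> in F. \<forall>u\<in>U. \<forall>b\<in>B. scale (rs \<alpha>) (\<sigma>s \<alpha> u b) \<in> W"
    by eventually_elim (use sub in blast)
qed

text \<open>
  Boundedness of \<open>\<sigma>(U, B)\<close> provides, for each \<open>W\<close>, a zero neighborhood of
  scalars mapping the whole set into \<open>W\<close>; the net of scalars enters it eventually.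
\<close>

lemma uniformly_null_shrink:
  assumes bounded: "\<And>B. module_bounded scale B \<Longrightarrow> module_bounded scale (image2 \<sigma> U B)"
    and rs: "(rs \<longlongrightarrow> 0) F"
  shows "uniformly_null scale F U (\<lambda>\<alpha> x y. scale (rs \<alpha>) (\<sigma> x y))"
proof (rule uniformly_nullI)
  fix W B :: "'x set" assume W: "zero_nhd W" and B: "module_bounded scale B"
  obtain V where V: "zero_nhd V" "\<forall>v\<in>V. \<forall>u\<in>U. \<forall>b\<in>B. scale v (\<sigma> u b) \<in> W"
    using bounded[OF B] W unfolding module_bounded_iff[of scale "image2 _ _ _"] ball_image2
    by blast
  from eventually_in_zero_nhd[OF rs V(1)]
  show "\<forall>\<^sub>F \<alpha> in F. \<forall>u\<in>U. \<forall>b\<in>B. scale (rs \<alpha>) (\<sigma> u b) \<in> W"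
    by eventually_elim (use V(2) in blast)
qed

end

lemma n2_tendsto_bi_add:
  assumes "directed_set D le" "n2_tendsto scale D le \<sigma>s \<sigma>" "n2_tendsto scale D le \<gamma>s \<gamma>"
  shows "n2_tendsto scale D le (\<lambda>\<alpha>. bi_add (\<sigma>s \<alpha>) (\<gamma>s \<alpha>)) (bi_add \<sigma> \<gamma>)"
proof -
  interpret directed_set D le by fact
  let ?null = "uniformly_null scale (net_filter D le)"
  obtain U1 U2 where U: "zero_nhd U1" "zero_nhd U2"
    and null: "?null U1 (\<lambda>\<alpha> x y. \<sigma>s \<alpha> x y - \<sigma> x y)" "?null U2 (\<lambda>\<alpha> x y. \<gamma>s \<alpha> x y - \<gamma> x y)"
    using assms(2,3) unfolding n2_tendsto_def n2_null_net_iff_uniformly_null by blast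
  have "?null (U1 \<inter> U2) (\<lambda>\<alpha> x y. (\<sigma>s \<alpha> x y - \<sigma> x y) + (\<gamma>s \<alpha> x y - \<gamma> x y))"
    using null by (intro uniformly_null_add) (auto elim: uniformly_null_subset)
  also have "(\<lambda>\<alpha> x y. (\<sigma>s \<alpha> x y - \<sigma> x y) + (\<gamma>s \<alpha> x y - \<gamma> x y)) =
      (\<lambda>\<alpha> x y. bi_add (\<sigma>s \<alpha>) (\<gamma>s \<alpha>) x y - bi_add \<sigma> \<gamma> x y)"
    by (simp add: bi_add_def algebra_simps)
  finally show ?thesis
    unfolding n2_tendsto_def n2_null_net_iff_uniformly_null using zero_nhd_Int[OF U] by blast
qed

lemma (in topological_module) n2_tendsto_bi_scale:
  assumes "directed_set D le" "n2_bounded scale \<sigma>" "n2_tendsto scale D le \<sigma>s \<sigma>"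
    and rs: "(rs \<longlongrightarrow> r) (net_filter D le)"
  shows "n2_tendsto scale D le (\<lambda>\<alpha>. bi_scale scale (rs \<alpha>) (\<sigma>s \<alpha>)) (bi_scale scale r \<sigma>)"
proof -
  interpret directed_set D le by fact
  let ?null = "uniformly_null scale (net_filter D le)"
  obtain U1 where U1: "zero_nhd U1" and null: "?null U1 (\<lambda>\<alpha> x y. \<sigma>s \<alpha> x y - \<sigma> x y)"
    using assms(3) unfolding n2_tendsto_def n2_null_net_iff_uniformly_null by blast
  obtain U2 where U2: "zero_nhd U2"
    and bounded: "\<And>B. module_bounded scale B \<Longrightarrow> module_bounded scale (image2 \<sigma> U2 B)"
    using assms(2) unfolding n2_bounded_def by blast
  have "((\<lambda>\<alpha>. rs \<alpha> - r) \<longlongrightarrow> 0) (net_filter D le)"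
    using tendsto_diff[OF rs tendsto_const[of r]] by simp
  with bounded have "?null U2 (\<lambda>\<alpha> x y. scale (rs \<alpha> - r) (\<sigma> x y))"
    by (rule uniformly_null_shrink)
  with uniformly_null_scale[OF null rs]
  have "?null (U1 \<inter> U2)
      (\<lambda>\<alpha> x y. scale (rs \<alpha>) (\<sigma>s \<alpha> x y - \<sigma> x y) + scale (rs \<alpha> - r) (\<sigma> x y))"
    by (intro uniformly_null_add) (auto elim: uniformly_null_subset)
  also have "(\<lambda>\<alpha> x y. scale (rs \<alpha>) (\<sigma>s \<alpha> x y - \<sigma> x y) + scale (rs \<alpha> - r) (\<sigma> x y)) =
      (\<lambda>\<alpha> x y. bi_scale scale (rs \<alpha>) (\<sigma>s \<alpha>) x y - bi_scale scale r \<sigma> x y)"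
    by (simp add: bi_scale_def scale_diff_right scale_diff_left)
  finally show ?thesis
    unfolding n2_tendsto_def n2_null_net_iff_uniformly_null using zero_nhd_Int[OF U1 U2] by blast
qed

theorem theorem7:
  fixes scale :: "'r::topological_ring \<Rightarrow> 'x::topological_ab_group_add \<Rightarrow> 'x"
    and D :: "'i set" and le :: "'i \<Rightarrow> 'i \<Rightarrow> bool"
    and \<sigma>s \<gamma>s :: "'i \<Rightarrow> 'x \<Rightarrow> 'x \<Rightarrow> 'x" and \<sigma> \<gamma> :: "'x \<Rightarrow> 'x \<Rightarrow> 'x"
    and rs :: "'i \<Rightarrow> 'r" and r :: 'r
  assumes "topological_module scale"
    and "directed_set D le"
    and "\<And>\<alpha>. \<alpha> \<in> D \<Longrightarrow> \<sigma>s \<alpha> \<in> B_n2 scale"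
    and "\<And>\<alpha>. \<alpha> \<in> D \<Longrightarrow> \<gamma>s \<alpha> \<in> B_n2 scale"
    and "\<sigma> \<in> B_n2 scale"
    and "\<gamma> \<in> B_n2 scale"
    and "n2_tendsto scale D le \<sigma>s \<sigma>"
    and "n2_tendsto scale D le \<gamma>s \<gamma>"
    and "(rs \<longlongrightarrow> r) (net_filter D le)"
  shows "n2_tendsto scale D le (\<lambda>\<alpha>. bi_add (\<sigma>s \<alpha>) (\<gamma>s \<alpha>)) (bi_add \<sigma> \<gamma>)
    \<and> n2_tendsto scale D le (\<lambda>\<alpha>. bi_scale scale (rs \<alpha>) (\<sigma>s \<alpha>)) (bi_scale scale r \<sigma>)"
  using assms by (simp add: B_n2_def n2_tendsto_bi_add topological_module.n2_tendsto_bi_scale)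

end
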